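(* Let $\gamma$ be a unit-speed $(n+2)$-differentiable regular curve in $\mathbb{E}^3$ with arc-length parameter $s$, let $1\le k\le n$, and let $\gamma_k$ be the $k$-principal direction curve of $\gamma$, with curvature $\kappa_k$, torsion $\tau_k$, principal normal vector $N_k$ and Darboux vector $W_k$. Then $\gamma$ is a curve of $N_k$-constant precession with the axis $\vec u=W_k+\mu N_k$ if and only if $$\kappa_k(s)=\omega\sin(\mu s)\quad\text{and}\quad \tau_k(s)=\omega\cos(\mu s),$$ where $\omega=\|W_k\|$ is the length of the Darboux vector $W_k$, and $\omega$ and $\mu$ are constants.
   Context: $\mathbb{E}^3$ is Euclidean 3-space. For a unit-speed curve $\gamma$ the Frenet frame is $T=\gamma'$, $N=\gamma''/\|\gamma''\|$, $B=T\times N$; the frames below are assumed to exist. Principal direction curves: the tangent direction curve of $\gamma$ is $\gamma_0(s)=\int T(s)\,ds$ (a translate of $\gamma$, with frame $T_0=T$, $N_0=N$, $B_0=B$). Recursively for $1\le k\le n$, the $k$-principal direction curve of $\gamma$ is $\gamma_k(s)=\int N_{k-1}(s)\,ds$, where $N_{k-1}$ is the principal normal vector of $\gamma_{k-1}$. It has the same arc-length parameter $s$ as $\gamma$, and its Frenet frame is $T_k=N_{k-1}$, $N_k=N_{k-1}'/\|N_{k-1}'\|$, $B_k=T_k\times N_k$. Its curvature $\kappa_k$ and torsion $\tau_k$ are given by the Frenet equations $T_k'=\kappa_kN_k$, $N_k'=-\kappa_kT_k+\tau_kB_k$, $B_k'=-\tau_kN_k$. The Darboux vector of $\gamma_k$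 is $W_k=\tau_kT_k+\kappa_kB_k$, so $\|W_k\|^2=\kappa_k^2+\tau_k^2$. The curve $\gamma$ is called a curve of $N_k$-constant precession with axis $\vec u$ if the Darboux vector $W_k$ of $\gamma_k$ makes a constant angle with a fixed direction $\vec u$ and has constant speed (constant length $\|W_k\|=\omega$) in terms of $\{T_k,N_k,B_k\}$.
   Formalization: As stated the equivalence fails: for a fixed μ the axis must be W_k − μN_k (with plus, μ is only existential on each side), the formulas hold after an arc-length shift s − s₀, and μ ≠ 0 is required of the axis since circular helices have constant W_k. *)

theory Defs
  imports "HOL-Analysis.Analysis"
begin

type_synonym curve = "real \<Rightarrow> real ^ 3"

definition times_differentiable_on :: "nat \<Rightarrow> curve \<Rightarrow> real set \<Rightarrow> bool" where
  "times_differentiable_on m f I \<longleftrightarrow>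
     (\<forall>j<m. \<forall>s\<in>I. ((\<lambda>g t. vector_derivative g (at t)) ^^ j) f differentiable (at s))"

text \<open>The Frenet apparatus of a unit-speed curve on an open interval. Outside the points where
  the derivatives exist the values are unspecified, so these notions are only meaningful together
  with \<open>frenet_curve_on\<close> below.\<close>

definition tangent :: "curve \<Rightarrow> curve" where
  "tangent \<beta> s = vector_derivative \<beta> (at s)"

definition normal :: "curve \<Rightarrow> curve" where
  "normal \<beta> s = vector_derivative (tangent \<beta>) (at s) /\<^sub>R norm (vector_derivative (tangent \<beta>) (at s))"

definition binormal :: "curve \<Rightarrow> curve" where
  "binormal \<beta> s = cross3 (tangent \<beta> s) (normal \<beta> s)"

definition curvature :: "curve \<Rightarrow> real \<Rightarrow> real" where
  "curvature \<beta> s = vector_derivative (tangent \<beta>) (at s) \<bullet> normal \<beta> s"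

definition torsion :: "curve \<Rightarrow> real \<Rightarrow> real" where
  "torsion \<beta> s = vector_derivative (normal \<beta>) (at s) \<bullet> binormal \<beta> s"

definition unit_speed_on :: "real set \<Rightarrow> curve \<Rightarrow> bool" where
  "unit_speed_on I \<beta> \<longleftrightarrow> (\<forall>s\<in>I. \<beta> differentiable (at s) \<and> norm (tangent \<beta> s) = 1)"

text \<open>Existence of the Frenet frame. Differentiability of the principal normal is included because
  torsion and the Frenet equations require it.\<close>

definition frenet_curve_on :: "real set \<Rightarrow> curve \<Rightarrow> bool" where
  "frenet_curve_on I \<beta> \<longleftrightarrow>
     (\<forall>s\<in>I. tangent \<beta> differentiable (at s) \<and>
            vector_derivative (tangent \<beta>) (at s) \<noteq> 0 \<and>
            normal \<beta> differentiable (at s))"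

lemma orthonormal_cross_expansion:
  fixes a b v :: "real ^ 3"
  assumes "a \<bullet> a = 1" "b \<bullet> b = 1" "a \<bullet> b = 0"
  shows "v = (v \<bullet> a) *\<^sub>R a + (v \<bullet> b) *\<^sub>R b + (v \<bullet> cross3 a b) *\<^sub>R cross3 a b"
proof -
  define c where "c = cross3 a b"
  have c: "c \<bullet> a = 0" "c \<bullet> b = 0" "a \<bullet> c = 0" "b \<bullet> c = 0"
    by (simp_all add: c_def dot_cross_self)
  have na: "norm a = 1" "norm b = 1" using assms by (simp_all add: norm_eq_1)
  have nc: "norm c = 1" using norm_cross_dot[of a b] assms na norm_ge_zero[of c]
    by (auto simp: c_def power2_eq_1_iff simp del: norm_ge_zero)
  hence cc: "c \<bullet> c = 1" by (simp add: norm_eq_1)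
  define w where "w = v - ((v \<bullet> a) *\<^sub>R a + (v \<bullet> b) *\<^sub>R b + (v \<bullet> c) *\<^sub>R c)"
  have w: "w \<bullet> a = 0" "w \<bullet> b = 0" "w \<bullet> c = 0"
    using assms c cc
    by (simp_all add: w_def inner_diff_left inner_add_left inner_commute[of b a])
  have "cross3 w c = 0" using w by (simp add: c_def Lagrange)
  hence "w = 0" using norm_cross_dot[of w c] w nc by simp
  thus ?thesis by (simp add: w_def c_def)
qed

lemma inner_const_derivative:
  fixes f :: curve
  assumes "open I" "s \<in> I" "\<And>t. t \<in> I \<Longrightarrow> f t \<bullet> f t = 1"
    and "(f has_vector_derivative f') (at s)"
  shows "f' \<bullet> f s = 0"
proof -
  have "((\<lambda>t. f t \<bullet> f t) has_vector_derivative (f s \<bullet> f' + f' \<bullet> f s)) (at s)"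
    by (rule bounded_bilinear.has_vector_derivative[OF bounded_bilinear_inner assms(4) assms(4)])
  moreover have "((\<lambda>t. f t \<bullet> f t) has_vector_derivative 0) (at s)"
    by (rule has_vector_derivative_transform_within_open[of "\<lambda>_. 1", OF _ assms(1,2)])
       (use assms(3) in auto)
  ultimately have "f s \<bullet> f' + f' \<bullet> f s = 0" by (rule vector_derivative_unique_at)
  thus ?thesis by (simp add: inner_commute)
qed

text \<open>The curvature and torsion above are the coefficients of the Frenet equations.\<close>

lemma frenet_equations:
  assumes "open I" "unit_speed_on I \<beta>" "frenet_curve_on I \<beta>" "s \<in> I"
  shows "(tangent \<beta> has_vector_derivative curvature \<beta> s *\<^sub>R normal \<beta> s) (at s)"
    and "(normal \<beta> has_vector_derivative
            - curvature \<beta> s *\<^sub>R tangent \<beta> s + torsion \<beta> s *\<^sub>R binormal \<beta> s) (at s)"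
    and "(binormal \<beta> has_vector_derivative - torsion \<beta> s *\<^sub>R normal \<beta> s) (at s)"
proof -
  let ?T = "tangent \<beta>" and ?N = "normal \<beta>" and ?B = "binormal \<beta>"
  have TT: "?T t \<bullet> ?T t = 1" if "t \<in> I" for t
    using assms(2) that by (simp add: unit_speed_on_def norm_eq_1)
  have NN: "?N t \<bullet> ?N t = 1" if "t \<in> I" for t
    using assms(3) that
    by (auto simp: frenet_curve_on_def normal_def dot_square_norm power2_eq_square)
  define T' N' where "T' = vector_derivative ?T (at s)" and "N' = vector_derivative ?N (at s)"
  have dT: "(?T has_vector_derivative T') (at s)" and dN: "(?N has_vector_derivative N') (at s)"
    and T'0: "T' \<noteq> 0"
    using assms(3,4) by (auto simp: frenet_curve_on_def T'_def N'_def vector_derivative_works)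
  have N_eq: "?N s = T' /\<^sub>R norm T'" by (simp add: normal_def T'_def)
  have "T' \<bullet> ?T s = 0" using inner_const_derivative[OF assms(1,4) TT dT] by simp
  hence NT: "?N s \<bullet> ?T s = 0" by (simp add: N_eq)
  have k: "curvature \<beta> s = norm T'"
    using T'0 by (simp add: curvature_def N_eq T'_def[symmetric] dot_square_norm power2_eq_square)
  have T'_eq: "T' = curvature \<beta> s *\<^sub>R ?N s" using T'0 by (simp add: k N_eq)
  show 1: "(?T has_vector_derivative curvature \<beta> s *\<^sub>R ?N s) (at s)" using dT T'_eq by simp
  have N'N: "N' \<bullet> ?N s = 0" using inner_const_derivative[OF assms(1,4) NN dN] by simp
  have BT: "?B t \<bullet> ?T t = 0" for t by (simp add: binormal_def dot_cross_self)
  have "((\<lambda>t. ?N t \<bullet> ?T t) has_vector_derivative (?N s \<bullet> T' + N' \<bullet> ?T s)) (at s)"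
    by (rule bounded_bilinear.has_vector_derivative[OF bounded_bilinear_inner dN dT])
  moreover have "((\<lambda>t. ?N t \<bullet> ?T t) has_vector_derivative 0) (at s)"
  proof (rule has_vector_derivative_transform_within_open[of "\<lambda>_. 0", OF _ assms(1,4)])
    fix t assume t: "t \<in> I"
    have "(?T has_vector_derivative vector_derivative ?T (at t)) (at t)"
      using assms(3) t by (auto simp: frenet_curve_on_def vector_derivative_works)
    from inner_const_derivative[OF assms(1) t TT this]
    show "0 = ?N t \<bullet> ?T t" by (simp add: normal_def)
  qed simp
  ultimately have "?N s \<bullet> T' + N' \<bullet> ?T s = 0" by (rule vector_derivative_unique_at)
  hence N'T: "N' \<bullet> ?T s = - curvature \<beta> s"
    using NN[OF assms(4)] by (simp add: T'_eq)
  have "N' = (N' \<bullet> ?T s) *\<^sub>R ?T s + (N' \<bullet> ?N s) *\<^sub>R ?N s + (N' \<bullet> ?B s) *\<^sub>R ?B s"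
    unfolding binormal_def
    by (rule orthonormal_cross_expansion) (use TT NN NT assms(4) in \<open>auto simp: inner_commute\<close>)
  hence N'_eq: "N' = - curvature \<beta> s *\<^sub>R ?T s + torsion \<beta> s *\<^sub>R ?B s"
    using N'T N'N by (simp add: torsion_def N'_def)
  show 2: "(?N has_vector_derivative
            - curvature \<beta> s *\<^sub>R ?T s + torsion \<beta> s *\<^sub>R ?B s) (at s)" using dN N'_eq by simp
  have bl: "bounded_bilinear cross3" using bilinear_cross by (simp add: bilinear_conv_bounded_bilinear)
  have "cross3 (?T s) (?B s) = - ?N s"
    using NT TT[OF assms(4)] by (simp add: binormal_def Lagrange inner_commute)
  hence "cross3 (?T s) (- curvature \<beta> s *\<^sub>R ?T s + torsion \<beta> s *\<^sub>R ?B s)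
      + cross3 (curvature \<beta> s *\<^sub>R ?N s) (?N s) = - torsion \<beta> s *\<^sub>R ?N s"
    by (simp add: Cross3.right_diff_distrib cross_mult_right cross_mult_left)
  with bounded_bilinear.has_vector_derivative[OF bl 1 2]
  show "(?B has_vector_derivative - torsion \<beta> s *\<^sub>R ?N s) (at s)"
    by (simp add: binormal_def[abs_def])
qed

definition darboux :: "curve \<Rightarrow> curve" where
  "darboux \<beta> s = torsion \<beta> s *\<^sub>R tangent \<beta> s + curvature \<beta> s *\<^sub>R binormal \<beta> s"

text \<open>\<open>principal_direction_curve I \<gamma> k \<delta>\<close>: \<open>\<delta>\<close> is a \<open>k\<close>-principal direction curve of \<open>\<gamma>\<close> on \<open>I\<close>.
  It is a relation because an indefinite integral is determined only up to a translation.\<close>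

primrec principal_direction_curve :: "real set \<Rightarrow> curve \<Rightarrow> nat \<Rightarrow> curve \<Rightarrow> bool" where
  "principal_direction_curve I \<gamma> 0 \<delta> \<longleftrightarrow>
     (\<forall>s\<in>I. (\<delta> has_vector_derivative tangent \<gamma> s) (at s))"
| "principal_direction_curve I \<gamma> (Suc k) \<delta> \<longleftrightarrow>
     (\<exists>\<beta>. principal_direction_curve I \<gamma> k \<beta> \<and> frenet_curve_on I \<beta> \<and>
          (\<forall>s\<in>I. (\<delta> has_vector_derivative normal \<beta> s) (at s)))"

definition vec_angle :: "real ^ 3 \<Rightarrow> real ^ 3 \<Rightarrow> real" where
  "vec_angle v w = arccos (v \<bullet> w / (norm v * norm w))"

text \<open>\<open>\<gamma>\<close> is a curve of \<open>N\<^sub>k\<close>-constant precession with axis the fixed vector \<open>u\<close>. The choice of the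
  \<open>k\<close>-principal direction curve \<open>\<delta>\<close> is immaterial, as translates have the same Darboux vector.\<close>

definition N_constant_precession :: "real set \<Rightarrow> nat \<Rightarrow> curve \<Rightarrow> real ^ 3 \<Rightarrow> bool" where
  "N_constant_precession I k \<gamma> u \<longleftrightarrow> u \<noteq> 0 \<and>
     (\<exists>\<delta>. principal_direction_curve I \<gamma> k \<delta> \<and> frenet_curve_on I \<delta> \<and>
        (\<exists>\<theta>. \<forall>s\<in>I. vec_angle (darboux \<delta> s) u = \<theta>) \<and>
        (\<exists>\<omega>. \<forall>s\<in>I. norm (darboux \<delta> s) = \<omega>))"

end

theory Submission
  imports Defs
begin

text \<open>
  The proof differentiates \<open>W - \<mu> N\<close> by the Frenet equations of \<open>\<gamma>\<^sub>k\<close>. They apply because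
  \<open>\<gamma>\<^sub>k\<close> has unit speed: for \<open>k \<ge> 1\<close> its tangent is the principal normal of a curve with a Frenet frame; write
  \<open>T, N, B, \<kappa>, \<tau>\<close> for its frame, curvature and torsion, and \<open>W = \<tau> T + \<kappa> B\<close>.

  If \<open>u = W - \<mu> N\<close> is a fixed vector, then \<open>\<tau> = u \<bullet> T\<close> and \<open>\<kappa> = u \<bullet> B\<close>. So both
  functions inherit differentiability from \<open>T\<close> and \<open>B\<close>, and the Frenet equations give
  \<open>\<kappa>' = \<mu> \<tau>\<close> and \<open>\<tau>' = - \<mu> \<kappa>\<close>. Hence \<open>(\<tau>, \<kappa>)\<close> rotates with angular velocity \<open>\<mu>\<close> on a circle whose
  radius is \<open>\<parallel>W\<parallel>\<close> (\<open>rotating_pair_sinusoidal\<close>). Conversely, for the sinusoidal functions the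
  derivative \<open>W' - \<mu> N' = (\<tau>' + \<mu> \<kappa>) T + (\<kappa>' - \<mu> \<tau>) B\<close> vanishes, so \<open>W - \<mu> N\<close> is fixed on the
  interval. These two directions are \<open>fixed_axis_iff_sinusoidal\<close>.

  A fixed axis of this form makes the length of \<open>W\<close> and its angle to \<open>u\<close> constant: \<open>W\<close> and \<open>N\<close> are
  orthogonal, so \<open>\<parallel>u\<parallel>\<^sup>2 = \<parallel>W\<parallel>\<^sup>2 + \<mu>\<^sup>2\<close> and \<open>W \<bullet> u = \<parallel>W\<parallel>\<^sup>2\<close>. In the first equivalence the sign
  of \<open>\<mu>\<close> is absorbed by the quantifier, and \<open>\<mu> = 0\<close> is excluded on the analytic side because it
  would give \<open>\<kappa> = 0\<close>.
\<close>

section \<open>The Frenet frame\<close>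

lemma frenet_normal_unit:
  assumes "frenet_curve_on I \<beta>" "s \<in> I"
  shows "norm (normal \<beta> s) = 1"
  using assms by (auto simp: frenet_curve_on_def normal_def)

lemma frenet_curvature_pos:
  assumes "frenet_curve_on I \<beta>" "s \<in> I"
  shows "curvature \<beta> s > 0"
  using assms
  by (simp add: frenet_curve_on_def curvature_def normal_def dot_square_norm power2_eq_square)

lemma frenet_tangent_normal_orthogonal:
  assumes "open I" "unit_speed_on I \<beta>" "frenet_curve_on I \<beta>" "s \<in> I"
  shows "tangent \<beta> s \<bullet> normal \<beta> s = 0"
proof -
  have "(curvature \<beta> s *\<^sub>R normal \<beta> s) \<bullet> tangent \<beta> s = 0"
    by (rule inner_const_derivative[OF assms(1,4) _ frenet_equations(1)[OF assms]])
       (use assms(2) in \<open>simp add: unit_speed_on_def norm_eq_1\<close>)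
  then show ?thesis
    using frenet_curvature_pos[OF assms(3,4)] by (simp add: inner_commute)
qed

lemma frenet_frame_orthonormal:
  assumes "open I" "unit_speed_on I \<beta>" "frenet_curve_on I \<beta>" "s \<in> I"
  shows "tangent \<beta> s \<bullet> tangent \<beta> s = 1" "normal \<beta> s \<bullet> normal \<beta> s = 1"
    and "binormal \<beta> s \<bullet> binormal \<beta> s = 1"
    and "tangent \<beta> s \<bullet> normal \<beta> s = 0" "normal \<beta> s \<bullet> tangent \<beta> s = 0"
    and "tangent \<beta> s \<bullet> binormal \<beta> s = 0" "binormal \<beta> s \<bullet> tangent \<beta> s = 0"
    and "normal \<beta> s \<bullet> binormal \<beta> s = 0" "binormal \<beta> s \<bullet> normal \<beta> s = 0"
proof -
  have T: "norm (tangent \<beta> s) = 1" using assms(2,4) by (simp add: unit_speed_on_def)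
  have N: "norm (normal \<beta> s) = 1" using assms(3,4) by (rule frenet_normal_unit)
  show TN: "tangent \<beta> s \<bullet> normal \<beta> s = 0"
    using assms by (rule frenet_tangent_normal_orthogonal)
  show "normal \<beta> s \<bullet> tangent \<beta> s = 0" using TN by (simp add: inner_commute)
  show "tangent \<beta> s \<bullet> tangent \<beta> s = 1" "normal \<beta> s \<bullet> normal \<beta> s = 1"
    using T N by (simp_all add: norm_eq_1)
  show "binormal \<beta> s \<bullet> binormal \<beta> s = 1"
    using norm_cross_dot[of "tangent \<beta> s" "normal \<beta> s"] T N TN
    by (simp add: binormal_def dot_square_norm)
  show "tangent \<beta> s \<bullet> binormal \<beta> s = 0" "binormal \<beta> s \<bullet> tangent \<beta> s = 0"
    "normal \<beta> s \<bullet> binormal \<beta> s = 0" "binormal \<beta> s \<bullet> normal \<beta> s = 0"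
    by (simp_all add: binormal_def dot_cross_self)
qed

lemma norm_darboux_squared:
  assumes "open I" "unit_speed_on I \<beta>" "frenet_curve_on I \<beta>" "s \<in> I"
  shows "(norm (darboux \<beta> s))\<^sup>2 = (curvature \<beta> s)\<^sup>2 + (torsion \<beta> s)\<^sup>2"
  unfolding power2_norm_eq_inner darboux_def
  by (simp add: inner_add_left inner_add_right frenet_frame_orthonormal[OF assms] power2_eq_square)

lemma darboux_orthogonal_normal:
  assumes "open I" "unit_speed_on I \<beta>" "frenet_curve_on I \<beta>" "s \<in> I"
  shows "darboux \<beta> s \<bullet> normal \<beta> s = 0"
  by (simp add: darboux_def inner_add_left frenet_frame_orthonormal[OF assms])

text \<open>The velocity of a principal direction curve is a principal normal, hence a unit vector.\<close>

lemma principal_direction_curve_unit_speed: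
  assumes "principal_direction_curve I \<gamma> k \<delta>" "1 \<le> k"
  shows "unit_speed_on I \<delta>"
proof -
  from assms obtain j where "k = Suc j" by (cases k) auto
  with assms obtain \<beta> where \<beta>: "frenet_curve_on I \<beta>"
    and d: "\<And>s. s \<in> I \<Longrightarrow> (\<delta> has_vector_derivative normal \<beta> s) (at s)"
    by auto
  have "\<delta> differentiable (at s) \<and> norm (tangent \<delta> s) = 1" if "s \<in> I" for s
    unfolding tangent_def vector_derivative_at[OF d[OF that]]
    using differentiableI_vector[OF d[OF that]] frenet_normal_unit[OF \<beta> that] by simp
  then show ?thesis by (simp add: unit_speed_on_def)
qed

section \<open>Pairs rotating with constant angular velocity\<close>

text \<open>Uniqueness for the linear system: \<open>x\<^sup>2 + y\<^sup>2\<close> is conserved.\<close>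

lemma rotating_pair_zero:
  fixes x y :: "real \<Rightarrow> real"
  assumes "convex I" "a \<in> I" "s \<in> I"
    and dx: "\<And>t. t \<in> I \<Longrightarrow> (x has_real_derivative \<mu> * y t) (at t within I)"
    and dy: "\<And>t. t \<in> I \<Longrightarrow> (y has_real_derivative - \<mu> * x t) (at t within I)"
    and "x a = 0" "y a = 0"
  shows "x s = 0" "y s = 0"
proof -
  have "((\<lambda>t. (x t)\<^sup>2 + (y t)\<^sup>2) has_real_derivative 0) (at t within I)" if "t \<in> I" for t
    using DERIV_add[OF DERIV_power[OF dx[OF that], of 2] DERIV_power[OF dy[OF that], of 2]]
    by (simp add: algebra_simps)
  from has_field_derivative_zero_constant[OF assms(1) this]
  obtain c where c: "\<And>t. t \<in> I \<Longrightarrow> (x t)\<^sup>2 + (y t)\<^sup>2 = c" by blast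
  from c[OF assms(2)] c[OF assms(3)] assms(6,7) have "(x s)\<^sup>2 + (y s)\<^sup>2 = 0" by simp
  then show "x s = 0" "y s = 0" by simp_all
qed

text \<open>The phase is read off from polar coordinates at one point of the interval; the difference to
  the sinusoidal solution with this phase solves the same system and vanishes there.\<close>

lemma rotating_pair_sinusoidal:
  fixes x y :: "real \<Rightarrow> real"
  assumes "convex I" "a \<in> I" "\<mu> \<noteq> 0"
    and dx: "\<And>t. t \<in> I \<Longrightarrow> (x has_real_derivative \<mu> * y t) (at t within I)"
    and dy: "\<And>t. t \<in> I \<Longrightarrow> (y has_real_derivative - \<mu> * x t) (at t within I)"
  obtains \<omega> s\<^sub>0 where "\<omega> \<ge> 0"
    and "\<And>s. s \<in> I \<Longrightarrow> x s = \<omega> * sin (\<mu> * (s - s\<^sub>0))"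
    and "\<And>s. s \<in> I \<Longrightarrow> y s = \<omega> * cos (\<mu> * (s - s\<^sub>0))"
proof -
  \<comment> \<open>Real part \<open>y\<close>, as the second component carries the cosine.\<close>
  define z where "z = Complex (y a) (x a)"
  define s\<^sub>0 where "s\<^sub>0 = a - Arg z / \<mu>"
  have phase: "\<mu> * (a - s\<^sub>0) = Arg z" using \<open>\<mu> \<noteq> 0\<close> by (simp add: s\<^sub>0_def)
  have z: "z = rcis (cmod z) (Arg z)" by (simp add: rcis_cmod_Arg)
  have xa: "x a = cmod z * sin (\<mu> * (a - s\<^sub>0))"
    using arg_cong[OF z, of Im] by (simp only: phase Im_rcis) (simp add: z_def)
  have ya: "y a = cmod z * cos (\<mu> * (a - s\<^sub>0))"
    using arg_cong[OF z, of Re] by (simp only: phase Re_rcis) (simp add: z_def)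
  define p where "p t = x t - cmod z * sin (\<mu> * (t - s\<^sub>0))" for t
  define q where "q t = y t - cmod z * cos (\<mu> * (t - s\<^sub>0))" for t
  have dp: "(p has_real_derivative \<mu> * q t) (at t within I)" if "t \<in> I" for t
    unfolding p_def q_def
    by (rule derivative_eq_intros dx[OF that] refl | simp add: algebra_simps)+
  have dq: "(q has_real_derivative - \<mu> * p t) (at t within I)" if "t \<in> I" for t
    unfolding p_def q_def
    by (rule derivative_eq_intros dy[OF that] refl | simp add: algebra_simps)+
  have "p s = 0" "q s = 0" if "s \<in> I" for s
    using rotating_pair_zero[OF assms(1,2) that dp dq] xa ya by (simp_all add: p_def q_def)
  then show ?thesis by (intro that[of "cmod z" s\<^sub>0]) (auto simp: p_def q_def)
qed

section \<open>Fixed axes and constant precession\<close>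

lemma fixed_axis_iff_sinusoidal:
  assumes "open I" "convex I" "I \<noteq> {}" "unit_speed_on I \<beta>" "frenet_curve_on I \<beta>" "\<mu> \<noteq> 0"
  shows "(\<exists>u. \<forall>s\<in>I. u = darboux \<beta> s - \<mu> *\<^sub>R normal \<beta> s) \<longleftrightarrow>
    (\<exists>\<omega> s\<^sub>0. \<forall>s\<in>I. \<omega> = norm (darboux \<beta> s) \<and>
       curvature \<beta> s = \<omega> * sin (\<mu> * (s - s\<^sub>0)) \<and> torsion \<beta> s = \<omega> * cos (\<mu> * (s - s\<^sub>0)))"
    (is "?fixed \<longleftrightarrow> ?sinusoidal")
proof
  note frame = frenet_frame_orthonormal[OF assms(1,4,5)]
  note frenet = frenet_equations[OF assms(1,4,5)]
  assume ?fixed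
  then obtain u where u: "\<And>s. s \<in> I \<Longrightarrow> u = darboux \<beta> s - \<mu> *\<^sub>R normal \<beta> s" by blast
  have uT: "u \<bullet> tangent \<beta> s = torsion \<beta> s" if "s \<in> I" for s
    unfolding u[OF that] darboux_def by (simp add: inner_add_left inner_diff_left frame[OF that])
  have uN: "u \<bullet> normal \<beta> s = - \<mu>" if "s \<in> I" for s
    unfolding u[OF that] darboux_def by (simp add: inner_add_left inner_diff_left frame[OF that])
  have uB: "u \<bullet> binormal \<beta> s = curvature \<beta> s" if "s \<in> I" for s
    unfolding u[OF that] darboux_def by (simp add: inner_add_left inner_diff_left frame[OF that])
  \<comment> \<open>Differentiating \<open>u \<bullet> B\<close> and \<open>u \<bullet> T\<close> leaves only the component \<open>u \<bullet> N = - \<mu>\<close>.\<close>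
  note inner_u = bounded_linear.has_vector_derivative[OF bounded_linear_inner_right[of u]]
  have d\<kappa>: "(curvature \<beta> has_real_derivative \<mu> * torsion \<beta> s) (at s within I)" if "s \<in> I" for s
  proof -
    have "((\<lambda>t. u \<bullet> binormal \<beta> t) has_vector_derivative \<mu> * torsion \<beta> s) (at s)"
      using inner_u[OF frenet(3)[OF that]] by (simp add: uN[OF that] mult.commute)
    then have "(curvature \<beta> has_vector_derivative \<mu> * torsion \<beta> s) (at s)"
      by (rule has_vector_derivative_transform_within_open[OF _ assms(1) that]) (rule uB)
    then show ?thesis
      by (simp add: has_real_derivative_iff_has_vector_derivative has_vector_derivative_at_within)
  qed
  have d\<tau>: "(torsion \<beta> has_real_derivative - \<mu> * curvature \<beta> s) (at s within I)"
    if "s \<in> I" for s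
  proof -
    have "((\<lambda>t. u \<bullet> tangent \<beta> t) has_vector_derivative - \<mu> * curvature \<beta> s) (at s)"
      using inner_u[OF frenet(1)[OF that]] by (simp add: uN[OF that] mult.commute)
    then have "(torsion \<beta> has_vector_derivative - \<mu> * curvature \<beta> s) (at s)"
      by (rule has_vector_derivative_transform_within_open[OF _ assms(1) that]) (rule uT)
    then show ?thesis
      by (simp add: has_real_derivative_iff_has_vector_derivative has_vector_derivative_at_within)
  qed
  from assms(3) obtain a where "a \<in> I" by blast
  from rotating_pair_sinusoidal[OF assms(2) this assms(6) d\<kappa> d\<tau>] obtain \<omega> s\<^sub>0
    where \<omega>: "\<omega> \<ge> 0"
      and \<kappa>: "\<And>s. s \<in> I \<Longrightarrow> curvature \<beta> s = \<omega> * sin (\<mu> * (s - s\<^sub>0))"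
      and \<tau>: "\<And>s. s \<in> I \<Longrightarrow> torsion \<beta> s = \<omega> * cos (\<mu> * (s - s\<^sub>0))"
    by blast
  have "\<omega> = norm (darboux \<beta> s)" if "s \<in> I" for s
  proof -
    have "(norm (darboux \<beta> s))\<^sup>2 = \<omega>\<^sup>2 * ((sin (\<mu> * (s - s\<^sub>0)))\<^sup>2 + (cos (\<mu> * (s - s\<^sub>0)))\<^sup>2)"
      unfolding norm_darboux_squared[OF assms(1,4,5) that] \<kappa>[OF that] \<tau>[OF that]
      by (simp only: power_mult_distrib distrib_left)
    then show ?thesis using \<omega> by simp
  qed
  then show ?sinusoidal
    by (intro exI[of _ \<omega>] exI[of _ s\<^sub>0] ballI conjI) (rule \<kappa> \<tau> | assumption)+
next
  note frenet = frenet_equations[OF assms(1,4,5)]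
  assume ?sinusoidal
  then obtain \<omega> s\<^sub>0
    where \<kappa>: "\<And>s. s \<in> I \<Longrightarrow> curvature \<beta> s = \<omega> * sin (\<mu> * (s - s\<^sub>0))"
      and \<tau>: "\<And>s. s \<in> I \<Longrightarrow> torsion \<beta> s = \<omega> * cos (\<mu> * (s - s\<^sub>0))"
    by blast
  have "((\<lambda>t. darboux \<beta> t - \<mu> *\<^sub>R normal \<beta> t) has_vector_derivative 0) (at s within I)"
    if s: "s \<in> I" for s
  proof -
    have "((\<lambda>t. \<omega> * sin (\<mu> * (t - s\<^sub>0))) has_real_derivative \<mu> * torsion \<beta> s) (at s)"
      by (rule derivative_eq_intros refl | simp add: \<tau>[OF s])+
    then have d\<kappa>: "(curvature \<beta> has_real_derivative \<mu> * torsion \<beta> s) (at s)"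
      by (rule has_field_derivative_transform_within_open[OF _ assms(1) s]) (simp add: \<kappa>)
    have "((\<lambda>t. \<omega> * cos (\<mu> * (t - s\<^sub>0))) has_real_derivative - \<mu> * curvature \<beta> s) (at s)"
      by (rule derivative_eq_intros refl | simp add: \<kappa>[OF s])+
    then have d\<tau>: "(torsion \<beta> has_real_derivative - \<mu> * curvature \<beta> s) (at s)"
      by (rule has_field_derivative_transform_within_open[OF _ assms(1) s]) (simp add: \<tau>)
    have dW: "(darboux \<beta> has_vector_derivative
        (torsion \<beta> s *\<^sub>R curvature \<beta> s *\<^sub>R normal \<beta> s + (- \<mu> * curvature \<beta> s) *\<^sub>R tangent \<beta> s)
        + (curvature \<beta> s *\<^sub>R (- torsion \<beta> s *\<^sub>R normal \<beta> s)
           + (\<mu> * torsion \<beta> s) *\<^sub>R binormal \<beta> s)) (at s)"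
      unfolding darboux_def[abs_def]
      by (intro has_vector_derivative_add has_vector_derivative_scaleR d\<kappa> d\<tau> frenet s)
    have "((\<lambda>t. \<mu> *\<^sub>R normal \<beta> t) has_vector_derivative
        \<mu> *\<^sub>R (- curvature \<beta> s *\<^sub>R tangent \<beta> s + torsion \<beta> s *\<^sub>R binormal \<beta> s)) (at s)"
      by (rule bounded_linear.has_vector_derivative[OF bounded_linear_scaleR_right frenet(2)[OF s]])
    from has_vector_derivative_diff[OF dW this] show ?thesis
      by (simp add: algebra_simps has_vector_derivative_at_within)
  qed
  from has_vector_derivative_zero_constant[OF assms(2) this]
  obtain u where "\<And>s. s \<in> I \<Longrightarrow> darboux \<beta> s - \<mu> *\<^sub>R normal \<beta> s = u" by blast
  then show ?fixed by (intro exI[of _ u]) simp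
qed

text \<open>Since \<open>W\<close> and \<open>N\<close> are orthogonal, the fixed length \<open>\<parallel>u\<parallel>\<^sup>2 = \<parallel>W\<parallel>\<^sup>2 + \<mu>\<^sup>2\<close> forces
  constant speed, and \<open>W \<bullet> u = \<parallel>W\<parallel>\<^sup>2\<close> then forces a constant angle.\<close>

lemma fixed_axis_imp_constant_precession:
  assumes "open I" "I \<noteq> {}" "principal_direction_curve I \<gamma> k \<delta>" "1 \<le> k"
    and "frenet_curve_on I \<delta>" "\<mu> \<noteq> 0"
    and u: "\<forall>s\<in>I. u = darboux \<delta> s - \<mu> *\<^sub>R normal \<delta> s"
  shows "N_constant_precession I k \<gamma> u"
proof -
  have unit: "unit_speed_on I \<delta>" using assms(3,4) by (rule principal_direction_curve_unit_speed)
  have orth: "darboux \<delta> s \<bullet> normal \<delta> s = 0" if "s \<in> I" for s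
    using assms(1) unit assms(5) that by (rule darboux_orthogonal_normal)
  have NN: "normal \<delta> s \<bullet> normal \<delta> s = 1" if "s \<in> I" for s
    using frenet_normal_unit[OF assms(5) that] by (simp add: norm_eq_1)
  have uu: "u \<bullet> u = (norm (darboux \<delta> s))\<^sup>2 + \<mu>\<^sup>2" if "s \<in> I" for s
    unfolding bspec[OF u that] power2_norm_eq_inner
    using orth[OF that] NN[OF that]
    by (simp add: inner_diff_left inner_diff_right inner_commute power2_eq_square)
  have Wu: "darboux \<delta> s \<bullet> u = (norm (darboux \<delta> s))\<^sup>2" if "s \<in> I" for s
    unfolding bspec[OF u that] power2_norm_eq_inner
    using orth[OF that] by (simp add: inner_diff_right)
  define \<omega> where "\<omega> = sqrt (u \<bullet> u - \<mu>\<^sup>2)"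
  have speed: "norm (darboux \<delta> s) = \<omega>" if "s \<in> I" for s
    by (simp add: \<omega>_def uu[OF that])
  have angle: "vec_angle (darboux \<delta> s) u = arccos (\<omega>\<^sup>2 / (\<omega> * norm u))" if "s \<in> I" for s
    by (simp add: vec_angle_def Wu[OF that] speed[OF that])
  from assms(2) obtain a where "a \<in> I" by blast
  have "u \<noteq> 0"
  proof
    assume "u = 0"
    with uu[OF \<open>a \<in> I\<close>] have "(norm (darboux \<delta> a))\<^sup>2 + \<mu>\<^sup>2 = 0" by simp
    with \<open>\<mu> \<noteq> 0\<close> show False by simp
  qed
  moreover have "\<exists>\<theta>. \<forall>s\<in>I. vec_angle (darboux \<delta> s) u = \<theta>"
    by (intro exI ballI) (rule angle)
  moreover have "\<exists>\<omega>. \<forall>s\<in>I. norm (darboux \<delta> s) = \<omega>"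
    by (intro exI ballI) (rule speed)
  ultimately show ?thesis
    unfolding N_constant_precession_def using assms(3,5) by blast
qed

theorem theorem4:
  fixes \<gamma> \<gamma>\<^sub>k :: "real \<Rightarrow> real ^ 3" and I :: "real set" and n k :: nat
  assumes "open I" and "is_interval I" and "I \<noteq> {}"
    and "times_differentiable_on (n + 2) \<gamma> I"
    and "unit_speed_on I \<gamma>"
    and "1 \<le> k" and "k \<le> n"
    and "principal_direction_curve I \<gamma> k \<gamma>\<^sub>k"
    and "frenet_curve_on I \<gamma>\<^sub>k"
  shows
    "((\<exists>\<mu> u. \<mu> \<noteq> 0 \<and> N_constant_precession I k \<gamma> u \<and>
             (\<forall>s\<in>I. u = darboux \<gamma>\<^sub>k s + \<mu> *\<^sub>R normal \<gamma>\<^sub>k s))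
      \<longleftrightarrow>
      (\<exists>\<omega> \<mu> s\<^sub>0. \<forall>s\<in>I. \<omega> = norm (darboux \<gamma>\<^sub>k s) \<and>
             curvature \<gamma>\<^sub>k s = \<omega> * sin (\<mu> * (s - s\<^sub>0)) \<and>
             torsion \<gamma>\<^sub>k s = \<omega> * cos (\<mu> * (s - s\<^sub>0))))
     \<and>
     (\<forall>\<mu>. \<mu> \<noteq> 0 \<longrightarrow>
      ((\<exists>u. N_constant_precession I k \<gamma> u \<and>
           (\<forall>s\<in>I. u = darboux \<gamma>\<^sub>k s - \<mu> *\<^sub>R normal \<gamma>\<^sub>k s))
      \<longleftrightarrow>
      (\<exists>\<omega> s\<^sub>0. \<forall>s\<in>I. \<omega> = norm (darboux \<gamma>\<^sub>k s) \<and>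
             curvature \<gamma>\<^sub>k s = \<omega> * sin (\<mu> * (s - s\<^sub>0)) \<and>
             torsion \<gamma>\<^sub>k s = \<omega> * cos (\<mu> * (s - s\<^sub>0)))))"
proof -
  have unit: "unit_speed_on I \<gamma>\<^sub>k" using assms(8,6) by (rule principal_direction_curve_unit_speed)
  have "convex I" using \<open>is_interval I\<close> by (rule is_interval_convex)
  let ?axis = "\<lambda>\<mu> u. N_constant_precession I k \<gamma> u \<and>
    (\<forall>s\<in>I. u = darboux \<gamma>\<^sub>k s - \<mu> *\<^sub>R normal \<gamma>\<^sub>k s)"
  let ?sinusoidal = "\<lambda>\<omega> \<mu> s\<^sub>0. \<forall>s\<in>I. \<omega> = norm (darboux \<gamma>\<^sub>k s) \<and>
    curvature \<gamma>\<^sub>k s = \<omega> * sin (\<mu> * (s - s\<^sub>0)) \<and> torsion \<gamma>\<^sub>k s = \<omega> * cos (\<mu> * (s - s\<^sub>0))"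
  have iff: "(\<exists>u. ?axis \<mu> u) \<longleftrightarrow> (\<exists>\<omega> s\<^sub>0. ?sinusoidal \<omega> \<mu> s\<^sub>0)" if "\<mu> \<noteq> 0" for \<mu>
  proof -
    have "(\<exists>u. ?axis \<mu> u) \<longleftrightarrow> (\<exists>u. \<forall>s\<in>I. u = darboux \<gamma>\<^sub>k s - \<mu> *\<^sub>R normal \<gamma>\<^sub>k s)"
      by (intro ex_cong1 iffI conjI fixed_axis_imp_constant_precession[OF assms(1,3,8,6,9) that])
         (erule conjunct2 | assumption)+
    also have "\<dots> \<longleftrightarrow> (\<exists>\<omega> s\<^sub>0. ?sinusoidal \<omega> \<mu> s\<^sub>0)"
      by (rule fixed_axis_iff_sinusoidal[OF assms(1) \<open>convex I\<close> assms(3) unit assms(9) that])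
    finally show ?thesis .
  qed
  have nonzero: "\<mu> \<noteq> 0" if "?sinusoidal \<omega> \<mu> s\<^sub>0" for \<omega> \<mu> s\<^sub>0
  proof
    assume "\<mu> = 0"
    from assms(3) obtain a where "a \<in> I" by blast
    with that \<open>\<mu> = 0\<close> have "curvature \<gamma>\<^sub>k a = 0" by simp
    with frenet_curvature_pos[OF assms(9) \<open>a \<in> I\<close>] show False by simp
  qed
  have "(\<exists>\<mu> u. \<mu> \<noteq> 0 \<and> N_constant_precession I k \<gamma> u \<and>
      (\<forall>s\<in>I. u = darboux \<gamma>\<^sub>k s + \<mu> *\<^sub>R normal \<gamma>\<^sub>k s)) \<longleftrightarrow> (\<exists>\<mu>. \<mu> \<noteq> 0 \<and> (\<exists>u. ?axis \<mu> u))"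
    (is "?plus \<longleftrightarrow> ?minus")
  proof
    assume ?plus
    then obtain \<mu> u where "\<mu> \<noteq> 0" "N_constant_precession I k \<gamma> u"
      "\<forall>s\<in>I. u = darboux \<gamma>\<^sub>k s + \<mu> *\<^sub>R normal \<gamma>\<^sub>k s" by blast
    then show ?minus by (intro exI[of _ "- \<mu>"] conjI exI[of _ u]) simp_all
  next
    assume ?minus
    then obtain \<mu> u where "\<mu> \<noteq> 0" "N_constant_precession I k \<gamma> u"
      "\<forall>s\<in>I. u = darboux \<gamma>\<^sub>k s - \<mu> *\<^sub>R normal \<gamma>\<^sub>k s" by blast
    then show ?plus by (intro exI[of _ "- \<mu>"] exI[of _ u] conjI) simp_all
  qed
  also have "\<dots> \<longleftrightarrow> (\<exists>\<mu>. \<mu> \<noteq> 0 \<and> (\<exists>\<omega> s\<^sub>0. ?sinusoidal \<omega> \<mu> s\<^sub>0))"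
    by (intro ex_cong1 conj_cong refl iff)
  also have "\<dots> \<longleftrightarrow> (\<exists>\<omega> \<mu> s\<^sub>0. ?sinusoidal \<omega> \<mu> s\<^sub>0)" (is "?l \<longleftrightarrow> ?r")
  proof
    assume ?l
    then show ?r by (elim exE conjE) (intro exI)
  next
    assume ?r
    then show ?l by (elim exE) (intro exI conjI, rule nonzero)
  qed
  finally show ?thesis by (intro conjI allI impI iff)
qed

end
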